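(* Let $G$ be either the De Bruijn digraph $B(d,D)$ or the Kautz digraph $K(d,D)$, with vertex set $V$. Let $v\in V$, $w\in S_1(v)$, and let $1\le i\le D$. Assume that $S_{i}^\star(v) \cap S_{j}^{\star}(w)=\emptyset$ for all $i\le j\le D$. Then $S_i^\star(v)= S_{i}^\star(v) \cap S_{i-1}^{\star}(w)$ and $$|S_{i}^\star(v) \cap S_{i-1}^{\star}(w)|= |S_{i}^\star(v)|=d^i-a_{i-1}d^{i-1}-\cdots -a_{1} d-a_{0},$$ where, for $0\le k\le i-1$, $a_k\in\{0,1\}$ and $a_k=1$ if and only if $S_{k,i}(v)\ne\emptyset$, and where, in this case, $d=2$ and $a_{i-1}=1$. Therefore $|S_{i}^\star(v)\cap S_{i-1}^{\star}(w)|$ can be equivalently expressed as $$|S_{i}^\star(v) \cap S_{i-1}^{\star}(w)|=d^{i-1}-a_{i-2}d^{i-2}-\cdots -a_{1} d-a_{0}.$$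
   Context: Let $d\ge 2$ and $D\ge 1$ be integers. The De Bruijn digraph $B(d,D)$ has as vertices all words $v=v_1v_2\cdots v_D$ over an alphabet $A$ with $|A|=d$; $v$ is adjacent to the $d$ vertices $v_2\cdots v_D v_{D+1}$, $v_{D+1}\in A$ (loops occur). The Kautz digraph $K(d,D)$ has as vertices all words $v=v_1v_2\cdots v_D$ over an alphabet $A$ with $|A|=d+1$ such that $v_k\ne v_{k+1}$ for $1\le k<D$; $v$ is adjacent to the $d$ vertices $v_2\cdots v_Dv_{D+1}$ with $v_{D+1}\in A$, $v_{D+1}\ne v_D$. Both are $d$-regular of diameter $D$. For $v\in V$ and $i\ge 0$, $S_i(v)$ is the set of vertices $u$ for which there is a walk of length exactly $i$ from $v$ to $u$ (so $S_1(v)$ is the set of vertices adjacent from $v$), and $S_i^\star(v)$ is the set of vertices at (directed) distance exactly $i$ from $v$. For integers $0\le k\le i\le D$: $S_{k,i}(v)=S_k(v)$ if $S_k(v)\subseteq S_i(v)$ and, for all $j$ with $k<j<i$ such that $S_j(v)\subseteq S_i(v)$, we have $S_k(v)\not\subseteq S_j(v)$; otherwise $S_{k,i}(v)=\emptyset$. *)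

theory Defs
  imports Graph_Theory.Graph_Theory
begin

text \<open>
  Words of length \<open>D\<close> are lists. Since \<open>D \<ge> 1\<close>, the vertex reached from \<open>v\<close> by dropping
  the first letter and appending \<open>x\<close> is \<open>tl v @ [x]\<close>.
\<close>

definition de_bruijn :: "'a set \<Rightarrow> nat \<Rightarrow> 'a list pair_pre_digraph" where
  "de_bruijn A D =
    \<lparr> pverts = {v. length v = D \<and> set v \<subseteq> A},
      parcs = {(v, tl v @ [x]) | v x. length v = D \<and> set v \<subseteq> A \<and> x \<in> A} \<rparr>"

definition kautz :: "'a set \<Rightarrow> nat \<Rightarrow> 'a list pair_pre_digraph" where
  "kautz A D =
    \<lparr> pverts = {v. length v = D \<and> set v \<subseteq> A \<and> distinct_adj v},
      parcs = {(v, tl v @ [x]) | v x.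
        length v = D \<and> set v \<subseteq> A \<and> distinct_adj v \<and> x \<in> A \<and> x \<noteq> last v} \<rparr>"

definition walk_sphere :: "'v pair_pre_digraph \<Rightarrow> nat \<Rightarrow> 'v \<Rightarrow> 'v set" where
  "walk_sphere G i v = {u. \<exists>p. pre_digraph.awalk G v p u \<and> length p = i}"

text \<open>
  With all arcs of cost \<open>1\<close>, the shortest-path cost \<open>\<mu>\<close> is the directed distance; it is
  \<open>\<infinity>\<close> for vertices that are not reachable.
\<close>

definition dist_sphere :: "'v pair_pre_digraph \<Rightarrow> nat \<Rightarrow> 'v \<Rightarrow> 'v set" where
  "dist_sphere G i v = {u. wf_digraph.\<mu> G (\<lambda>_. 1) v u = ereal (real i)}"

definition maximal_walk_sphere :: "'v pair_pre_digraph \<Rightarrow> nat \<Rightarrow> nat \<Rightarrow> 'v \<Rightarrow> 'v set" where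
  "maximal_walk_sphere G k i v =
    (if walk_sphere G k v \<subseteq> walk_sphere G i v \<and>
        (\<forall>j. k < j \<and> j < i \<and> walk_sphere G j v \<subseteq> walk_sphere G i v \<longrightarrow>
             \<not> walk_sphere G k v \<subseteq> walk_sphere G j v)
     then walk_sphere G k v else {})"

text \<open>
  \<open>wf_digraph.\<mu>\<close> only has its defining equation for well-formed digraphs.
\<close>

lemma wf_digraph_de_bruijn:
  assumes "1 \<le> D"
  shows "wf_digraph (with_proj (de_bruijn A D))"
proof
  fix e assume "e \<in> arcs (with_proj (de_bruijn A D))"
  then obtain v x where e: "e = (v, tl v @ [x])" "length v = D" "set v \<subseteq> A" "x \<in> A"
    by (auto simp: de_bruijn_def)
  have "set (tl v) \<subseteq> A" using e(3) by (cases v) auto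
  then show "tail (with_proj (de_bruijn A D)) e \<in> verts (with_proj (de_bruijn A D))"
    and "head (with_proj (de_bruijn A D)) e \<in> verts (with_proj (de_bruijn A D))"
    using e assms by (auto simp: de_bruijn_def)
qed

lemma wf_digraph_kautz:
  assumes "1 \<le> D"
  shows "wf_digraph (with_proj (kautz A D))"
proof
  fix e assume "e \<in> arcs (with_proj (kautz A D))"
  then obtain v x where e: "e = (v, tl v @ [x])" "length v = D" "set v \<subseteq> A" "x \<in> A"
      "distinct_adj v" "x \<noteq> last v"
    by (auto simp: kautz_def)
  have "set (tl v) \<subseteq> A" using e(3) by (cases v) auto
  moreover have "distinct_adj (tl v @ [x])"
    using e(5,6) by (cases v) (auto simp: distinct_adj_append_iff distinct_adj_Cons)
  ultimately show "tail (with_proj (kautz A D)) e \<in> verts (with_proj (kautz A D))"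
    and "head (with_proj (kautz A D)) e \<in> verts (with_proj (kautz A D))"
    using e assms by (auto simp: kautz_def)
qed

end

theory Submission
  imports Defs
begin

text \<open>
  Walking \<open>k \<le> D\<close> steps from \<open>v\<close> deletes the first \<open>k\<close> letters of \<open>v\<close> and appends \<open>k\<close> new ones,
  each with \<open>d\<close> possible values. So \<open>S\<^sub>k(v)\<close> has exactly \<open>d\<^sup>k\<close> elements, all with
  the same first \<open>D - k\<close> letters, while membership in \<open>S\<^sub>i(v)\<close> depends only on the first
  \<open>D - i + 1\<close> letters (\<open>mem_walk_sphere_iff\<close>). Hence for \<open>k < i\<close> the set \<open>S\<^sub>k(v)\<close> is either contained in \<open>S\<^sub>i(v)\<close> or
  disjoint from it (\<open>walk_spheres_nested_or_disjoint\<close>). The vertices at distance \<open>i\<close> are those of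
  \<open>S\<^sub>i(v)\<close> outside all earlier \<open>S\<^sub>k(v)\<close>; because of the dichotomy, what is removed is the disjoint
  union of the maximal \<open>S\<^sub>k(v)\<close> inside \<open>S\<^sub>i(v)\<close>. This gives
  \<open>d\<^sup>i - (\<Sum>k<i. a\<^sub>k d\<^sup>k)\<close> vertices at distance \<open>i\<close>, for every vertex \<open>v\<close>.

  A vertex \<open>u\<close> at distance \<open>i\<close> from \<open>v\<close> has distance at least \<open>i - 1\<close> from the out-neighbour \<open>w\<close>,
  and at most \<open>D\<close> since \<open>D\<close> bounds the diameter. If the distances \<open>i, \<dots>, D\<close> never occur, it is
  exactly \<open>i - 1\<close>. All vertices at distance \<open>i\<close> from \<open>v\<close> then lie in \<open>S\<^bsub>i-1\<^esub>(w)\<close>, which has only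
  \<open>d\<^bsup>i-1\<^esup>\<close> elements, so the digits \<open>a\<^sub>k\<close> must remove at least \<open>(d - 1) d\<^bsup>i-1\<^esup>\<close> elements. As the
  digits below \<open>a\<^bsub>i-1\<^esub>\<close> remove fewer than \<open>d\<^bsup>i-1\<^esup>\<close>, this is possible only if \<open>d = 2\<close> and
  \<open>a\<^bsub>i-1\<^esub> = 1\<close>.
\<close>

section \<open>Distance spheres from walk spheres\<close>

lemma walk_sphere_0:
  assumes "v \<in> pverts G"
  shows "walk_sphere G 0 v = {v}"
  using assms by (auto simp: walk_sphere_def pre_digraph.awalk_def pre_digraph.cas.simps)

lemma walk_sphere_Suc:
  assumes wf: "wf_digraph (with_proj G)"
  shows "walk_sphere G (Suc i) v = {u. \<exists>x\<in>walk_sphere G i v. (x, u) \<in> parcs G}"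
proof -
  interpret wf_digraph "with_proj G" by (rule wf)
  have "u \<in> walk_sphere G (Suc i) v \<longleftrightarrow> (\<exists>x\<in>walk_sphere G i v. (x, u) \<in> parcs G)" for u
  proof
    assume "u \<in> walk_sphere G (Suc i) v"
    then obtain p where p: "awalk v p u" "length p = Suc i"
      by (auto simp: walk_sphere_def)
    then obtain q e where q: "p = q @ [e]" by (metis length_Suc_conv_rev)
    have "awalk v q (awlast v q)" "awalk (awlast v q) [e] u"
      using p(1) unfolding q by simp_all
    moreover from this(2) have "e = (awlast v q, u)" "e \<in> parcs G"
      by (auto simp: awalk_Cons_iff awalk_Nil_iff prod_eq_iff)
    ultimately show "\<exists>x\<in>walk_sphere G i v. (x, u) \<in> parcs G"
      using p(2) q by (auto simp: walk_sphere_def)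
  next
    assume "\<exists>x\<in>walk_sphere G i v. (x, u) \<in> parcs G"
    then obtain x p where "awalk v p x" "length p = i" "(x, u) \<in> parcs G"
      by (auto simp: walk_sphere_def)
    moreover from this(3) have "awalk x [(x, u)] u"
      using wellformed[of "(x, u)"] by (simp add: awalk_Cons_iff awalk_Nil_iff)
    ultimately have "awalk v (p @ [(x, u)]) u" "length (p @ [(x, u)]) = Suc i"
      by (auto intro: awalk_appendI)
    then show "u \<in> walk_sphere G (Suc i) v"
      unfolding walk_sphere_def by blast
  qed
  then show ?thesis by blast
qed

lemma walk_sphere_ConsI:
  assumes wf: "wf_digraph (with_proj G)"
    and "w \<in> walk_sphere G 1 v" "u \<in> walk_sphere G j w"
  shows "u \<in> walk_sphere G (Suc j) v"
proof -
  interpret wf_digraph "with_proj G" by (rule wf)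
  obtain p q where "awalk v p w" "length p = 1" "awalk w q u" "length q = j"
    using assms(2,3) by (auto simp: walk_sphere_def)
  then have "awalk v (p @ q) u" "length (p @ q) = Suc j"
    by (auto intro: awalk_appendI)
  then show ?thesis unfolding walk_sphere_def by blast
qed

text \<open>
  Costs of walks are natural numbers, so the infimum that defines the distance is attained as
  soon as some walk exists.
\<close>

lemma dist_sphere_eq_walk_sphere_diff:
  assumes wf: "wf_digraph (with_proj G)"
  shows "dist_sphere G i v = walk_sphere G i v - (\<Union>k<i. walk_sphere G k v)"
proof -
  interpret wf_digraph "with_proj G" by (rule wf)
  have cost: "awalk_cost (\<lambda>_. 1) p = real (length p)" for p :: "('a \<times> 'a) list"
    by (induction p) auto
  have "\<mu> (\<lambda>_. 1) v u = ereal (real i) \<longleftrightarrow>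
      u \<in> walk_sphere G i v \<and> (\<forall>k<i. u \<notin> walk_sphere G k v)" for u
  proof (cases "\<exists>k. u \<in> walk_sphere G k v")
    case False
    then have "\<not> v \<rightarrow>\<^sup>*\<^bsub>with_proj G\<^esub> u"
      by (auto simp: reachable_awalk walk_sphere_def)
    then show ?thesis using False by (simp add: shortest_path_inf)
  next
    case True
    define m where "m = (LEAST k. u \<in> walk_sphere G k v)"
    have m: "u \<in> walk_sphere G m v"
      unfolding m_def using True by (rule LeastI_ex)
    have m_le: "m \<le> k" if "u \<in> walk_sphere G k v" for k
      unfolding m_def using that by (rule Least_le)
    have "\<mu> (\<lambda>_. 1) v u = ereal (real m)"
      unfolding \<mu>_def
    proof (rule INF_eqI)
      show "ereal (real m) \<le> ereal (awalk_cost (\<lambda>_. 1) p)" if "p \<in> {p. awalk v p u}" for p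
        using that m_le[of "length p"] by (auto simp: cost walk_sphere_def)
    next
      fix y :: ereal
      assume "\<And>p. p \<in> {p. awalk v p u} \<Longrightarrow> y \<le> ereal (awalk_cost (\<lambda>_. 1) p)"
      then show "y \<le> ereal (real m)"
        using m by (auto simp: cost walk_sphere_def)
    qed
    moreover have "m = i \<longleftrightarrow> u \<in> walk_sphere G i v \<and> (\<forall>k<i. u \<notin> walk_sphere G k v)"
      using m m_le by (metis le_less not_le)
    ultimately show ?thesis by simp
  qed
  then show ?thesis by (auto simp: dist_sphere_def)
qed

section \<open>Digraphs of admissible words\<close>

text \<open>
  Both families are digraphs on the words whose consecutive letters are related by a relation
  \<open>R\<close>: the full relation gives the De Bruijn digraph, inequality the Kautz digraph.
\<close>

definition word_digraph :: "('a \<Rightarrow> 'a \<Rightarrow> bool) \<Rightarrow> 'a set \<Rightarrow> nat \<Rightarrow> 'a list pair_pre_digraph" where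
  "word_digraph R A D =
    \<lparr> pverts = {v. length v = D \<and> set v \<subseteq> A \<and> successively R v},
      parcs = {(v, tl v @ [x]) | v x.
        length v = D \<and> set v \<subseteq> A \<and> successively R v \<and> x \<in> A \<and> R (last v) x} \<rparr>"

lemma de_bruijn_eq_word_digraph: "de_bruijn A D = word_digraph (\<lambda>_ _. True) A D"
  by (simp add: de_bruijn_def word_digraph_def successively_conv_nth)

lemma kautz_eq_word_digraph: "kautz A D = word_digraph (\<noteq>) A D"
  by (auto simp: kautz_def word_digraph_def distinct_adj_def)

text \<open>
  Relatedness of distinct letters is what bounds the diameter by \<open>D\<close>: of two
  words, the second can be appended to the first if the letters at the junction differ, and
  overlapped with it in one letter if they are equal.
\<close>

locale word_relation =
  fixes R :: "'a \<Rightarrow> 'a \<Rightarrow> bool" and A :: "'a set" and d D :: nat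
  assumes finite_alphabet: "finite A"
    and card_successors: "a \<in> A \<Longrightarrow> card {x \<in> A. R a x} = d"
    and distinct_related: "a \<in> A \<Longrightarrow> b \<in> A \<Longrightarrow> a \<noteq> b \<Longrightarrow> R a b"
    and D_pos: "1 \<le> D"
begin

abbreviation G :: "'a list pair_pre_digraph" where
  "G \<equiv> word_digraph R A D"

lemma wf_word_digraph: "wf_digraph (with_proj G)"
proof
  fix e assume "e \<in> arcs (with_proj G)"
  then obtain v x where e: "e = (v, tl v @ [x])" "length v = D" "set v \<subseteq> A" "x \<in> A"
      "successively R v" "R (last v) x"
    by (auto simp: word_digraph_def)
  have "set (tl v) \<subseteq> A" using e(3) by (cases v) auto
  moreover have "successively R (tl v @ [x])"
    using e(5,6) by (cases v) (auto simp: successively_append_iff successively_Cons split: if_splits)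
  ultimately show "tail (with_proj G) e \<in> verts (with_proj G)"
    and "head (with_proj G) e \<in> verts (with_proj G)"
    using e D_pos by (auto simp: word_digraph_def)
qed

text \<open>
  The letters that are appended during a walk of length \<open>i\<close> from \<open>v\<close>. Admissibility is required
  of all of \<open>v @ y\<close>, so that this set stays meaningful when \<open>i = D\<close> and nothing of \<open>v\<close> itself
  is left in the word reached.
\<close>

definition extensions :: "'a list \<Rightarrow> nat \<Rightarrow> 'a list set" where
  "extensions v i = {y. length y = i \<and> set y \<subseteq> A \<and> successively R (v @ y)}"

lemma extensions_Suc:
  assumes "v \<noteq> []"
  shows "extensions v (Suc i) =
    (\<lambda>(y, x). y @ [x]) ` (SIGMA y:extensions v i. {x \<in> A. R (last (v @ y)) x})"
proof -
  have "y @ [x] \<in> extensions v (Suc i) \<longleftrightarrow>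
      y \<in> extensions v i \<and> x \<in> A \<and> R (last (v @ y)) x" for y x
    using assms successively_append_iff[of R "v @ y" "[x]"] by (auto simp: extensions_def)
  moreover have "\<exists>y x. z = y @ [x]" if "z \<in> extensions v (Suc i)" for z
    using that by (auto simp: extensions_def length_Suc_conv_rev)
  ultimately show ?thesis by (fastforce simp: image_iff)
qed

lemma finite_extensions: "finite (extensions v i)"
  by (rule finite_subset[OF _ finite_lists_length_eq[OF finite_alphabet, of i]])
    (auto simp: extensions_def)

lemma card_extensions:
  assumes v: "v \<in> pverts G"
  shows "card (extensions v i) = d ^ i"
proof (induction i)
  case 0
  have "extensions v 0 = {[]}" using v by (auto simp: extensions_def word_digraph_def)
  then show ?case by simp
next
  case (Suc i)
  have v': "v \<noteq> []" "set v \<subseteq> A" using v D_pos by (auto simp: word_digraph_def)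
  have "card {x \<in> A. R (last (v @ y)) x} = d" if "y \<in> extensions v i" for y
  proof (rule card_successors)
    have "last (v @ y) \<in> set (v @ y)" using v'(1) by (intro last_in_set) simp
    then show "last (v @ y) \<in> A" using that v'(2) by (auto simp: extensions_def)
  qed
  moreover have "inj_on (\<lambda>(y, x). y @ [x]) X" for X :: "('a list \<times> 'a) set"
    by (auto simp: inj_on_def)
  ultimately show ?case
    using Suc finite_extensions[of v i] finite_alphabet
    by (simp add: extensions_Suc[OF v'(1)] card_image)
qed

lemma walk_sphere_eq_image_extensions:
  assumes v: "v \<in> pverts G" and "i \<le> D"
  shows "walk_sphere G i v = (\<lambda>y. drop i v @ y) ` extensions v i"
  using \<open>i \<le> D\<close>
proof (induction i)
  case 0
  have "extensions v 0 = {[]}" using v by (auto simp: extensions_def word_digraph_def)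
  then show ?case by (simp add: walk_sphere_0[OF v])
next
  case (Suc i)
  have v': "length v = D" "set v \<subseteq> A" "successively R v" "v \<noteq> []"
    using v D_pos by (auto simp: word_digraph_def)
  have ne: "drop i v \<noteq> []" using Suc.prems v' by simp
  have arc: "(drop i v @ y, u) \<in> parcs G \<longleftrightarrow>
      (\<exists>x\<in>A. R (last (v @ y)) x \<and> u = drop (Suc i) v @ (y @ [x]))"
    if y: "y \<in> extensions v i" for y u
  proof -
    have "successively R (drop i v @ y)"
    proof -
      have "v @ y = take i v @ (drop i v @ y)" by simp
      then show ?thesis using y unfolding extensions_def
        by (metis (mono_tags, lifting) mem_Collect_eq successively_append_iff)
    qed
    moreover have "set (drop i v @ y) \<subseteq> A"
      using y v'(2) set_drop_subset[of i v] by (auto simp: extensions_def)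
    moreover have "length (drop i v @ y) = D"
      using y v'(1) Suc.prems by (simp add: extensions_def)
    moreover have "last (drop i v @ y) = last (v @ y)"
      using ne by (auto simp: last_append)
    moreover have "tl (drop i v @ y) = drop (Suc i) v @ y"
      using ne by (simp add: drop_Suc tl_drop)
    ultimately show ?thesis unfolding word_digraph_def by auto
  qed
  have "walk_sphere G (Suc i) v = {u. \<exists>y\<in>extensions v i. (drop i v @ y, u) \<in> parcs G}"
    using Suc by (simp add: walk_sphere_Suc[OF wf_word_digraph])
  also have "\<dots> = (\<lambda>y. drop (Suc i) v @ y) ` extensions v (Suc i)"
    using arc by (auto simp: extensions_Suc[OF v'(4)] image_iff)
  finally show ?case .
qed

lemma card_walk_sphere:
  assumes "v \<in> pverts G" "i \<le> D"
  shows "card (walk_sphere G i v) = d ^ i" and "finite (walk_sphere G i v)"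
  using card_extensions[OF assms(1)] finite_extensions
  by (simp_all add: walk_sphere_eq_image_extensions[OF assms] card_image inj_on_def)

text \<open>
  The condition on \<open>u\<close> involves only its first \<open>D - i + 1\<close> letters: \<open>D - i\<close> of them are inherited
  from \<open>v\<close>, and the next one must be allowed after the last letter of \<open>v\<close>. For \<open>i = D\<close> no letter is inherited
  and the memory of \<open>v\<close> is in the second condition alone; for \<open>i = 0\<close> there is no next letter.
\<close>

lemma mem_walk_sphere_iff:
  assumes v: "v \<in> pverts G" and "i \<le> D"
  shows "u \<in> walk_sphere G i v \<longleftrightarrow>
    u \<in> pverts G \<and> take (D - i) u = drop i v \<and> (i = 0 \<or> R (last v) (u ! (D - i)))"
proof -
  have v': "length v = D" "set v \<subseteq> A" "successively R v" "v \<noteq> []"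
    using v D_pos by (auto simp: word_digraph_def)
  show ?thesis
  proof
    assume "u \<in> walk_sphere G i v"
    then obtain y where y: "y \<in> extensions v i" "u = drop i v @ y"
      by (auto simp: walk_sphere_eq_image_extensions[OF assms])
    have "successively R (take i v @ u)" using y by (simp add: extensions_def flip: append_assoc)
    then have "successively R u" by (simp add: successively_append_iff)
    moreover have "set u \<subseteq> A" "length u = D"
      using y v' \<open>i \<le> D\<close> set_drop_subset[of i v] by (auto simp: extensions_def)
    moreover have "R (last v) (u ! (D - i))" if "i \<noteq> 0"
    proof -
      have "y \<noteq> []" using that y by (auto simp: extensions_def)
      moreover have "u ! (D - i) = hd y"
        using y v' \<open>y \<noteq> []\<close> by (simp add: nth_append hd_conv_nth)
      ultimately show ?thesis
        using y v' by (simp add: extensions_def successively_append_iff)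
    qed
    ultimately show "u \<in> pverts G \<and> take (D - i) u = drop i v \<and>
        (i = 0 \<or> R (last v) (u ! (D - i)))"
      using y v' by (auto simp: word_digraph_def)
  next
    assume u: "u \<in> pverts G \<and> take (D - i) u = drop i v \<and>
        (i = 0 \<or> R (last v) (u ! (D - i)))"
    then have u': "length u = D" "set u \<subseteq> A" "successively R u"
      by (auto simp: word_digraph_def)
    define y where "y = drop (D - i) u"
    have u_eq: "u = drop i v @ y" using u unfolding y_def by (metis append_take_drop_id)
    have "successively R y" using u'(3) unfolding u_eq by (simp add: successively_append_iff)
    moreover have "y = [] \<or> R (last v) (hd y)"
      using u u'(1) by (cases "D - i < D") (auto simp: y_def hd_drop_conv_nth)
    ultimately have "y \<in> extensions v i"
      using u'(1,2) v'(3) \<open>i \<le> D\<close> set_drop_subset[of "D - i" u]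
      by (auto simp: extensions_def successively_append_iff y_def)
    then show "u \<in> walk_sphere G i v"
      using u_eq by (auto simp: walk_sphere_eq_image_extensions[OF assms])
  qed
qed

text \<open>
  Elements of \<open>S\<^sub>k(v)\<close> agree in their first \<open>D - k\<close> letters, and \<open>D - k \<ge> D - i + 1\<close> letters suffice
  to decide membership in \<open>S\<^sub>i(v)\<close>. So one common element forces inclusion.
\<close>

lemma walk_spheres_nested_or_disjoint:
  assumes v: "v \<in> pverts G" and "k < i" "i \<le> D"
    and u0: "u0 \<in> walk_sphere G k v" "u0 \<in> walk_sphere G i v"
  shows "walk_sphere G k v \<subseteq> walk_sphere G i v"
proof
  fix u assume u: "u \<in> walk_sphere G k v"
  have k: "k \<le> D" using assms by simp
  have "take (D - k) u = take (D - k) u0"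
    using u u0 by (simp add: mem_walk_sphere_iff[OF v k])
  moreover have "D - i < D - k" using assms by simp
  ultimately have "take (D - i) u = take (D - i) u0" "u ! (D - i) = u0 ! (D - i)"
    by (metis min.absorb1 less_imp_le take_take, metis nth_take)
  then show "u \<in> walk_sphere G i v"
    using u u0(2) k by (simp add: mem_walk_sphere_iff[OF v] \<open>i \<le> D\<close>)
qed

text \<open>
  Appending all of \<open>u\<close> to \<open>w\<close> takes \<open>D\<close> steps, overlapping the two in one letter takes \<open>D - 1\<close>;
  one of these is always possible.
\<close>

lemma within_distance_D:
  assumes w: "w \<in> pverts G" and u: "u \<in> pverts G"
  shows "\<exists>j\<le>D. u \<in> walk_sphere G j w"
proof -
  have w': "w \<noteq> []" "length w = D" "set w \<subseteq> A"
    and u': "u \<noteq> []" "length u = D" "set u \<subseteq> A" "successively R u"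
    using u w D_pos by (auto simp: word_digraph_def)
  have A: "last w \<in> A" "u ! 0 \<in> A"
    using w' u' by (auto simp: subset_iff)
  show ?thesis
  proof (cases "u ! 0 = last w")
    case False
    then have "u \<in> walk_sphere G D w"
      using u w' A distinct_related by (subst mem_walk_sphere_iff[OF w]) auto
    then show ?thesis by blast
  next
    case True
    have "take 1 u = [u ! 0]" using u'(1) by (cases u) auto
    moreover have "drop (D - 1) w = [last w]"
      using w'(1,2) by (metis append_butlast_last_id append_eq_conv_conj length_butlast)
    moreover have "D - 1 = 0 \<or> R (last w) (u ! 1)"
      using u'(2,4) True by (cases "D - 1 = 0") (auto simp: successively_conv_nth dest: spec[of _ 0])
    ultimately have "u \<in> walk_sphere G (D - 1) w"
      using u D_pos True by (subst mem_walk_sphere_iff[OF w]) auto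
    then show ?thesis using diff_le_self by blast
  qed
qed

end

section \<open>Counting in a laminar chain\<close>

text \<open>
  Every point of \<open>S i\<close> that some earlier set contains lies in exactly one maximal earlier set:
  the last one containing it is maximal by laminarity, and two distinct maximal sets are
  disjoint, since otherwise the smaller-indexed one would be contained in the other.
\<close>

lemma card_diff_laminar:
  fixes S :: "nat \<Rightarrow> 'v set" and d i :: nat
  assumes fin: "\<And>k. k \<le> i \<Longrightarrow> finite (S k)" and card: "\<And>k. k \<le> i \<Longrightarrow> card (S k) = d ^ k"
    and laminar: "\<And>k j x. k < j \<Longrightarrow> j \<le> i \<Longrightarrow> x \<in> S k \<Longrightarrow> x \<in> S j \<Longrightarrow> S k \<subseteq> S j"
    and M: "M = {k. k < i \<and> S k \<subseteq> S i \<and> (\<forall>j. k < j \<and> j < i \<and> S j \<subseteq> S i \<longrightarrow> \<not> S k \<subseteq> S j)}"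
  shows "int (card (S i - (\<Union>k<i. S k))) = int d ^ i - (\<Sum>k\<in>M. int d ^ k)"
proof -
  have finM: "finite M" unfolding M by simp
  have covered: "\<exists>m\<in>M. x \<in> S m" if "x \<in> S i" "k < i" "x \<in> S k" for x k
  proof -
    let ?m = "Max {k. k < i \<and> x \<in> S k}"
    have "?m \<in> {k. k < i \<and> x \<in> S k}" using that by (intro Max_in) auto
    then have m: "?m < i" "x \<in> S ?m" by auto
    have "\<not> S ?m \<subseteq> S j" if j: "?m < j" "j < i" for j
    proof
      assume "S ?m \<subseteq> S j"
      then have "j \<le> ?m" using m(2) j(2) by (intro Max_ge) auto
      then show False using j(1) by simp
    qed
    then have "?m \<in> M" using m laminar[of ?m i x] \<open>x \<in> S i\<close> by (auto simp: M)
    then show ?thesis using m(2) by blast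
  qed
  have "S i - (\<Union>k<i. S k) = S i - (\<Union>k\<in>M. S k)"
    using covered by (auto simp: M)
  moreover have "card (\<Union>k\<in>M. S k) = (\<Sum>k\<in>M. d ^ k)"
  proof -
    have disj: "S k \<inter> S j = {}" if "k \<in> M" "j \<in> M" "k < j" for k j
      using that laminar[of k j] by (auto simp: M)
    have "card (\<Union>k\<in>M. S k) = (\<Sum>k\<in>M. card (S k))"
    proof (rule card_UN_disjoint[OF finM])
      show "\<forall>k\<in>M. finite (S k)" using fin by (auto simp: M)
      show "\<forall>k\<in>M. \<forall>j\<in>M. k \<noteq> j \<longrightarrow> S k \<inter> S j = {}"
        using disj by (metis Int_commute nat_neq_iff)
    qed
    then show ?thesis using card by (simp add: M)
  qed
  moreover have sub: "(\<Union>k\<in>M. S k) \<subseteq> S i" by (auto simp: M)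
  ultimately have "card (S i - (\<Union>k<i. S k)) = d ^ i - (\<Sum>k\<in>M. d ^ k)"
      "(\<Sum>k\<in>M. d ^ k) \<le> d ^ i"
    using card_mono[OF fin sub] card[of i]
    by (simp_all add: card_Diff_subset finite_subset[OF _ fin])
  then show ?thesis by (simp add: of_nat_diff)
qed

text \<open>
  Digits \<open>0, 1\<close> in base \<open>d\<close> at positions below \<open>m\<close> sum to less than \<open>d\<^sup>m\<close>, but the hypothesis
  asks for a sum of at least \<open>(d - 1) d\<^sup>m\<close> from the positions up to \<open>m\<close>. Dividing by \<open>d\<^sup>m\<close> gives
  \<open>d - 1 < 1 + a\<^sub>m \<le> 2\<close>.
\<close>

lemma zero_one_digits_large_sum:
  fixes a :: "nat \<Rightarrow> int" and d m :: nat
  assumes d: "2 \<le> d" and a: "\<And>k. k \<le> m \<Longrightarrow> a k \<in> {0, 1}"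
    and le: "int d ^ Suc m - (\<Sum>k<Suc m. a k * int d ^ k) \<le> int d ^ m"
  shows "d = 2" and "a m = 1"
proof -
  have less: "(\<Sum>k<n. a k * int d ^ k) < int d ^ n" if "n \<le> m" for n
    using that
  proof (induction n)
    case (Suc n)
    have "a n * int d ^ n \<le> 1 * int d ^ n"
      using a[of n] Suc.prems by (intro mult_right_mono) auto
    then have "(\<Sum>k<Suc n. a k * int d ^ k) < 2 * int d ^ n" using Suc by simp
    also have "\<dots> \<le> int d ^ Suc n" using d by (auto intro: mult_right_mono)
    finally show ?case .
  qed simp
  have "(int d - 1) * int d ^ m \<le> (\<Sum>k<m. a k * int d ^ k) + a m * int d ^ m"
    using le by (simp add: algebra_simps)
  also have "\<dots> < (1 + a m) * int d ^ m" using less[of m] by (simp add: algebra_simps)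
  finally have "int d - 1 < 1 + a m" by (simp add: mult_less_cancel_right)
  then show "d = 2" "a m = 1" using a[of m] d by auto
qed

section \<open>The intersection of distance spheres\<close>

text \<open>
  The digit \<open>a k\<close> is the indicator of maximality of \<open>S\<^sub>k(v)\<close> in \<open>S\<^sub>i(v)\<close>: walk spheres are
  nonempty, so \<open>maximal_walk_sphere\<close> is empty only when maximality fails.
\<close>

lemma (in word_relation) card_dist_sphere:
  fixes a :: "nat \<Rightarrow> int"
  assumes v: "v \<in> pverts G" and "i \<le> D" and "d \<noteq> 0"
    and a: "\<forall>k<i. a k \<in> {0, 1} \<and> (a k = 1 \<longleftrightarrow> maximal_walk_sphere G k i v \<noteq> {})"
  shows "int (card (dist_sphere G i v)) = int d ^ i - (\<Sum>k<i. a k * int d ^ k)"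
proof -
  let ?S = "\<lambda>k. walk_sphere G k v"
  define M where "M = {k. k < i \<and> ?S k \<subseteq> ?S i \<and>
    (\<forall>j. k < j \<and> j < i \<and> ?S j \<subseteq> ?S i \<longrightarrow> \<not> ?S k \<subseteq> ?S j)}"
  have "a k = (if k \<in> M then 1 else 0)" if "k < i" for k
  proof -
    have "card (?S k) \<noteq> 0"
      using card_walk_sphere(1)[OF v, of k] that \<open>i \<le> D\<close> \<open>d \<noteq> 0\<close> by simp
    then have "?S k \<noteq> {}" by auto
    then have "maximal_walk_sphere G k i v \<noteq> {} \<longleftrightarrow> k \<in> M"
      using that by (simp add: maximal_walk_sphere_def M_def)
    then show ?thesis using a that by auto
  qed
  then have "(\<Sum>k<i. a k * int d ^ k) = (\<Sum>k<i. if k \<in> M then int d ^ k else 0)"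
    by (intro sum.cong) auto
  also have "\<dots> = (\<Sum>k\<in>M. int d ^ k)"
    by (rule sum.mono_neutral_cong_right) (auto simp: M_def)
  finally have "(\<Sum>k<i. a k * int d ^ k) = (\<Sum>k\<in>M. int d ^ k)" .
  moreover have "int (card (?S i - (\<Union>k<i. ?S k))) = int d ^ i - (\<Sum>k\<in>M. int d ^ k)"
    using card_walk_sphere[OF v] walk_spheres_nested_or_disjoint[OF v] \<open>i \<le> D\<close>
    by (intro card_diff_laminar[OF _ _ _ M_def]) auto
  ultimately show ?thesis
    by (simp add: dist_sphere_eq_walk_sphere_diff[OF wf_word_digraph])
qed

text \<open>
  The distance from \<open>w\<close> to a vertex at distance \<open>i\<close> from \<open>v\<close> lies between \<open>i - 1\<close>, by the arc
  from \<open>v\<close> to \<open>w\<close>, and \<open>D\<close>; the hypothesis excludes everything but \<open>i - 1\<close>.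
\<close>

lemma (in word_relation) dist_sphere_subset_previous:
  assumes v: "v \<in> pverts G" and w: "w \<in> walk_sphere G 1 v" and "i \<le> D"
    and far: "\<forall>j. i \<le> j \<and> j \<le> D \<longrightarrow> dist_sphere G i v \<inter> dist_sphere G j w = {}"
  shows "dist_sphere G i v \<subseteq> dist_sphere G (i - 1) w"
proof
  note dist = dist_sphere_eq_walk_sphere_diff[OF wf_word_digraph]
  fix u assume u: "u \<in> dist_sphere G i v"
  have "u \<in> pverts G" "w \<in> pverts G"
    using u w D_pos \<open>i \<le> D\<close> by (auto simp: dist mem_walk_sphere_iff[OF v])
  then obtain j where j: "j \<le> D" "u \<in> walk_sphere G j w"
    using within_distance_D by blast
  define m where "m = (LEAST j. u \<in> walk_sphere G j w)"
  have m: "u \<in> walk_sphere G m w" unfolding m_def using j(2) by (rule LeastI)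
  have "m \<le> D" unfolding m_def using j by (meson Least_le order_trans)
  have m_dist: "u \<in> dist_sphere G m w"
    using m not_less_Least unfolding dist m_def by blast
  have "m < i" using far u m_dist \<open>m \<le> D\<close> by (metis disjoint_iff not_le)
  moreover have "i \<le> Suc m"
    using u walk_sphere_ConsI[OF wf_word_digraph w m] by (auto simp: dist not_less)
  ultimately have "m = i - 1" by simp
  then show "u \<in> dist_sphere G (i - 1) w" using m_dist by simp
qed

theorem theorem3:
  fixes d D i :: nat and A :: "'a set" and G :: "'a list pair_pre_digraph"
    and v w :: "'a list" and a :: "nat \<Rightarrow> int"
  assumes "2 \<le> d" and "1 \<le> D"
    and "(card A = d \<and> G = de_bruijn A D) \<or> (card A = d + 1 \<and> G = kautz A D)"
    and "v \<in> pverts G" and "w \<in> walk_sphere G 1 v"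
    and "1 \<le> i" and "i \<le> D"
    and "\<forall>j. i \<le> j \<and> j \<le> D \<longrightarrow> dist_sphere G i v \<inter> dist_sphere G j w = {}"
    and "\<forall>k<i. a k \<in> {0, 1} \<and> (a k = 1 \<longleftrightarrow> maximal_walk_sphere G k i v \<noteq> {})"
  shows "dist_sphere G i v = dist_sphere G i v \<inter> dist_sphere G (i - 1) w \<and>
    card (dist_sphere G i v \<inter> dist_sphere G (i - 1) w) = card (dist_sphere G i v) \<and>
    int (card (dist_sphere G i v)) = int d ^ i - (\<Sum>k<i. a k * int d ^ k) \<and>
    d = 2 \<and> a (i - 1) = 1 \<and>
    int (card (dist_sphere G i v \<inter> dist_sphere G (i - 1) w)) =
      int d ^ (i - 1) - (\<Sum>k<i - 1. a k * int d ^ k)"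
proof -
  obtain R where G: "G = word_digraph R A D" and "word_relation R A d D"
  proof (cases "card A = d \<and> G = de_bruijn A D")
    case True
    then have "finite A" using \<open>2 \<le> d\<close> by (intro card_ge_0_finite) simp
    then have "word_relation (\<lambda>_ _. True) A d D"
      using True \<open>1 \<le> D\<close> by unfold_locales auto
    then show thesis using that True by (simp add: de_bruijn_eq_word_digraph)
  next
    case False
    then have A: "card A = d + 1" "G = kautz A D" using assms(3) by auto
    then have "finite A" by (intro card_ge_0_finite) simp
    moreover have "card {x \<in> A. a \<noteq> x} = d" if "a \<in> A" for a
    proof -
      have "{x \<in> A. a \<noteq> x} = A - {a}" by auto
      then show ?thesis using that A(1) \<open>finite A\<close> by simp
    qed
    ultimately have "word_relation (\<noteq>) A d D"
      using \<open>1 \<le> D\<close> by unfold_locales auto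
    then show thesis using that A(2) by (simp add: kautz_eq_word_digraph)
  qed
  then interpret W: word_relation R A d D by simp
  note v = \<open>v \<in> pverts G\<close>[unfolded G]
  have sub: "dist_sphere G i v \<subseteq> dist_sphere G (i - 1) w"
    using assms(5-8) W.dist_sphere_subset_previous[OF v] unfolding G by blast
  have card: "int (card (dist_sphere G i v)) = int d ^ i - (\<Sum>k<i. a k * int d ^ k)"
    using assms(1,7,9) W.card_dist_sphere[OF v] unfolding G by simp
  obtain m where m: "i = Suc m" using \<open>1 \<le> i\<close> by (cases i) auto
  have w: "w \<in> pverts (word_digraph R A D)"
    using assms(2,5) W.mem_walk_sphere_iff[OF v] unfolding G by blast
  have "dist_sphere G i v \<subseteq> walk_sphere G m w"
    using sub m unfolding G
    by (auto simp: dist_sphere_eq_walk_sphere_diff[OF W.wf_word_digraph])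
  then have "card (dist_sphere G i v) \<le> d ^ m"
    using W.card_walk_sphere[OF w, of m] m \<open>i \<le> D\<close> card_mono unfolding G
    by (metis Suc_leD)
  then have "int d ^ Suc m - (\<Sum>k<Suc m. a k * int d ^ k) \<le> int d ^ m"
    using card by (simp add: m flip: of_nat_power)
  moreover have "a k \<in> {0, 1}" if "k \<le> m" for k
    using assms(9) that unfolding m by (metis less_Suc_eq_le)
  ultimately have d: "d = 2" and am: "a m = 1"
    using zero_one_digits_large_sum[of d m a] \<open>2 \<le> d\<close> by blast+
  then have "int d ^ i - (\<Sum>k<i. a k * int d ^ k) =
      int d ^ (i - 1) - (\<Sum>k<i - 1. a k * int d ^ k)"
    by (simp add: m)
  moreover have "dist_sphere G i v \<inter> dist_sphere G (i - 1) w = dist_sphere G i v"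
    using sub by blast
  ultimately show ?thesis using card d am by (simp add: m)
qed

end
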